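(* Let $M_1,\dots,M_k$ be matroids on the same finite ground set $E$. Suppose there are sets $V_1,\dots,V_k$ such that $V_i$ is independent in $M_i$ for each $i$, and $V_1\cup\dots\cup V_k=E$. Then Alice has a winning strategy in the generalized modified indicated coloring game on $M_1,\dots,M_k$.
   Context: The generalized modified indicated coloring game on matroids $M_1,\dots,M_k$ over a common ground set $E$, with color set $\{1,\dots,k\}$: in each turn Bob decides which of two kinds of move is played: (1) Alice indicates an uncolored element of $E$ and Bob colors it with a color from $\{1,\dots,k\}$; or (2) Bob indicates an uncolored element of $E$ and Alice colors it with a color from $\{1,\dots,k\}$. Both players must obey the rule that for each $i$ the elements colored $i$ form an independent set in $M_i$. If in some turn the player who must color has no admissible move, the game ends. Alice wins if all of $E$ has been colored; Bob wins if a partial coloring is reached that cannot be properly extended. *)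

theory Defs
  imports Main
begin

locale matroid =
  fixes E :: "'a set" and indep :: "'a set \<Rightarrow> bool"
  assumes finite_ground: "finite E"
    and indep_subset_ground: "indep X \<Longrightarrow> X \<subseteq> E"
    and indep_empty: "indep {}"
    and indep_subset: "indep X \<Longrightarrow> Y \<subseteq> X \<Longrightarrow> indep Y"
    and augmentation: "indep X \<Longrightarrow> indep Y \<Longrightarrow> card X < card Y \<Longrightarrow> \<exists>y\<in>Y - X. indep (insert y X)"

text \<open>A completed turn records who indicated, the indicated element and the color it received
  from the other player.  A history lists the completed turns, most recent first.\<close>

datatype 'a turn = Alice_Indicated 'a nat | Bob_Indicated 'a nat

fun coloring :: "'a turn list \<Rightarrow> 'a \<rightharpoonup> nat" where
  "coloring [] = Map.empty"
| "coloring (Alice_Indicated x i # h) = (coloring h)(x \<mapsto> i)"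
| "coloring (Bob_Indicated x i # h) = (coloring h)(x \<mapsto> i)"

definition uncolored :: "'a set \<Rightarrow> 'a turn list \<Rightarrow> 'a set" where
  "uncolored E h = E - dom (coloring h)"

definition proper :: "nat \<Rightarrow> (nat \<Rightarrow> 'a set \<Rightarrow> bool) \<Rightarrow> ('a \<rightharpoonup> nat) \<Rightarrow> bool" where
  "proper k indep c \<longleftrightarrow> (\<forall>i\<in>{1..k}. indep i {x. c x = Some i})"

definition admissible ::
  "nat \<Rightarrow> (nat \<Rightarrow> 'a set \<Rightarrow> bool) \<Rightarrow> 'a turn list \<Rightarrow> 'a \<Rightarrow> nat \<Rightarrow> bool" where
  "admissible k indep h x i \<longleftrightarrow> i \<in> {1..k} \<and> proper k indep ((coloring h)(x \<mapsto> i))"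

text \<open>The decision awaited within the current turn; a turn begins with Bob choosing its kind.\<close>

datatype 'a stage =
    Bob_Chooses_Kind
  | Alice_Indicates | Bob_Colors 'a
  | Bob_Indicates | Alice_Colors 'a

type_synonym 'a position = "'a turn list \<times> 'a stage"

inductive move ::
  "'a set \<Rightarrow> nat \<Rightarrow> (nat \<Rightarrow> 'a set \<Rightarrow> bool) \<Rightarrow> 'a position \<Rightarrow> 'a position \<Rightarrow> bool"
  for E :: "'a set" and k :: nat and indep :: "nat \<Rightarrow> 'a set \<Rightarrow> bool" where
  choose_first_kind:
    "uncolored E h \<noteq> {} \<Longrightarrow> move E k indep (h, Bob_Chooses_Kind) (h, Alice_Indicates)"
| choose_second_kind:
    "uncolored E h \<noteq> {} \<Longrightarrow> move E k indep (h, Bob_Chooses_Kind) (h, Bob_Indicates)"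
| Alice_indicates:
    "x \<in> uncolored E h \<Longrightarrow> move E k indep (h, Alice_Indicates) (h, Bob_Colors x)"
| Bob_colors:
    "admissible k indep h x i \<Longrightarrow>
      move E k indep (h, Bob_Colors x) (Alice_Indicated x i # h, Bob_Chooses_Kind)"
| Bob_indicates:
    "x \<in> uncolored E h \<Longrightarrow> move E k indep (h, Bob_Indicates) (h, Alice_Colors x)"
| Alice_colors:
    "admissible k indep h x i \<Longrightarrow>
      move E k indep (h, Alice_Colors x) (Bob_Indicated x i # h, Bob_Chooses_Kind)"

definition game_over ::
  "'a set \<Rightarrow> nat \<Rightarrow> (nat \<Rightarrow> 'a set \<Rightarrow> bool) \<Rightarrow> 'a position \<Rightarrow> bool" where
  "game_over E k indep p \<longleftrightarrow> (\<nexists>q. move E k indep p q)"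

fun Alice_to_move :: "'a position \<Rightarrow> bool" where
  "Alice_to_move (h, Alice_Indicates) \<longleftrightarrow> True"
| "Alice_to_move (h, Alice_Colors x) \<longleftrightarrow> True"
| "Alice_to_move (h, _) \<longleftrightarrow> False"

text \<open>Positions contain the whole history, so a map from positions to positions is a strategy
  that may depend on everything that has happened so far.\<close>

definition Alice_strategy ::
  "'a set \<Rightarrow> nat \<Rightarrow> (nat \<Rightarrow> 'a set \<Rightarrow> bool) \<Rightarrow> ('a position \<Rightarrow> 'a position) \<Rightarrow> bool" where
  "Alice_strategy E k indep \<sigma> \<longleftrightarrow>
    (\<forall>p. Alice_to_move p \<and> \<not> game_over E k indep p \<longrightarrow> move E k indep p (\<sigma> p))"

inductive consistent ::
  "'a set \<Rightarrow> nat \<Rightarrow> (nat \<Rightarrow> 'a set \<Rightarrow> bool) \<Rightarrow> ('a position \<Rightarrow> 'a position) \<Rightarrow> 'a position \<Rightarrow> bool"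
  for E :: "'a set" and k :: nat and indep :: "nat \<Rightarrow> 'a set \<Rightarrow> bool"
    and \<sigma> :: "'a position \<Rightarrow> 'a position" where
  start: "consistent E k indep \<sigma> ([], Bob_Chooses_Kind)"
| Bob_moves:
    "consistent E k indep \<sigma> p \<Longrightarrow> \<not> Alice_to_move p \<Longrightarrow> move E k indep p q \<Longrightarrow>
      consistent E k indep \<sigma> q"
| Alice_moves:
    "consistent E k indep \<sigma> p \<Longrightarrow> Alice_to_move p \<Longrightarrow> \<not> game_over E k indep p \<Longrightarrow>
      consistent E k indep \<sigma> (\<sigma> p)"

text \<open>Every turn colors a new element of \<^term>\<open>E\<close>, so for finite \<^term>\<open>E\<close> every play reaches a
  position where the game is over; it is won by Alice if and only if no uncolored element is left.
  An incomplete final coloring is one that cannot be properly extended: the indicated element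
  has no admissible color.\<close>

definition Alice_winning_strategy ::
  "'a set \<Rightarrow> nat \<Rightarrow> (nat \<Rightarrow> 'a set \<Rightarrow> bool) \<Rightarrow> ('a position \<Rightarrow> 'a position) \<Rightarrow> bool" where
  "Alice_winning_strategy E k indep \<sigma> \<longleftrightarrow>
    Alice_strategy E k indep \<sigma> \<and>
    (\<forall>h s. consistent E k indep \<sigma> (h, s) \<and> game_over E k indep (h, s) \<longrightarrow> uncolored E h = {})"

end

theory Submission
  imports Defs
begin

text \<open>Write \<open>C\<^sub>i\<close> for the set of elements of color \<open>i\<close> and \<open>g\<^sub>i\<close> for the rank function of the
  contraction \<open>M\<^sub>i / C\<^sub>i\<close>.  Alice keeps the Hall-type condition that \<open>|A| \<le> \<Sum>\<^sub>i g\<^sub>i A\<close> for every set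
  \<open>A\<close> of uncolored elements; it holds initially because \<open>|A \<inter> V\<^sub>i| \<le> r\<^sub>i A\<close>, and applied to
  singletons it shows that every uncolored element has an admissible color.  Coloring \<open>x\<close> with
  \<open>i\<close> destroys the condition only if some tight set \<open>A\<close> (one with equality) avoids \<open>x\<close> and
  satisfies \<open>g\<^sub>i (A \<union> {x}) = g\<^sub>i A\<close>.  By submodularity, unions and intersections of tight sets are
  tight.

  If Bob indicates \<open>x\<close>, let \<open>A\<close> be the union of all tight sets avoiding \<open>x\<close>.  As \<open>A\<close> is tight,
  the condition for \<open>A \<union> {x}\<close> yields a color \<open>i\<close> with \<open>g\<^sub>i (A \<union> {x}) > g\<^sub>i A\<close>, which is safe.
  If Alice has to indicate, she picks \<open>x\<close> in a minimal nonempty tight set \<open>T\<close> (any \<open>x\<close> if there is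
  none).  A tight set \<open>A\<close> avoiding \<open>x\<close> is then disjoint from \<open>T\<close>, and
  \<open>g\<^sub>i (A \<union> T) = g\<^sub>i A + g\<^sub>i T\<close> forces \<open>g\<^sub>i (A \<union> {x}) > g\<^sub>i A\<close> for each color \<open>i\<close> admissible at \<open>x\<close>.\<close>

section \<open>Systems of submodular functions with a Hall condition\<close>

locale hall_system =
  fixes I :: "'i set" and U :: "'a set" and g :: "'i \<Rightarrow> 'a set \<Rightarrow> int"
  assumes finite_index: "finite I"
    and finite_ground: "finite U"
    and mono: "i \<in> I \<Longrightarrow> A \<subseteq> B \<Longrightarrow> B \<subseteq> U \<Longrightarrow> g i A \<le> g i B"
    and submodular: "i \<in> I \<Longrightarrow> A \<subseteq> U \<Longrightarrow> B \<subseteq> U \<Longrightarrow> g i (A \<union> B) + g i (A \<inter> B) \<le> g i A + g i B"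
    and empty: "i \<in> I \<Longrightarrow> g i {} = 0"
    and hall: "A \<subseteq> U \<Longrightarrow> int (card A) \<le> (\<Sum>i\<in>I. g i A)"
begin

definition tight :: "'a set \<Rightarrow> bool" where
  "tight A \<longleftrightarrow> A \<subseteq> U \<and> (\<Sum>i\<in>I. g i A) = int (card A)"

lemma tight_empty: "tight {}"
  by (simp add: tight_def empty)

text \<open>Since \<open>card\<close> is modular, the slack of a set \<open>A\<close>, the sum of
  all \<open>g i A\<close> minus \<open>card A\<close>, is submodular, and \<open>hall\<close> makes
  it nonnegative. Slack 0 at \<open>A\<close> and \<open>B\<close> thus forces slack 0 at union and
  intersection, and equality in submodularity at each single index.\<close>

lemma
  assumes "tight A" "tight B"
  shows tight_union: "tight (A \<union> B)"
    and tight_inter: "tight (A \<inter> B)"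
    and tight_modular: "i \<in> I \<Longrightarrow> g i (A \<union> B) + g i (A \<inter> B) = g i A + g i B"
proof -
  let ?d = "\<lambda>i. (g i A + g i B) - (g i (A \<union> B) + g i (A \<inter> B))"
  have sub: "A \<subseteq> U" "B \<subseteq> U" and eq: "(\<Sum>i\<in>I. g i A) = int (card A)" "(\<Sum>i\<in>I. g i B) = int (card B)"
    using assms by (auto simp: tight_def)
  have "finite A" "finite B"
    using sub finite_ground finite_subset by auto
  then have card: "int (card A) + int (card B) = int (card (A \<union> B)) + int (card (A \<inter> B))"
    using card_Un_Int[of A B] by linarith
  have nonneg: "0 \<le> ?d i" if "i \<in> I" for i
    using submodular[OF that sub] by simp
  have sum: "(\<Sum>i\<in>I. ?d i)
      = (int (card A) + int (card B)) - ((\<Sum>i\<in>I. g i (A \<union> B)) + (\<Sum>i\<in>I. g i (A \<inter> B)))"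
    using eq by (simp add: sum.distrib sum_subtractf)
  have "int (card (A \<union> B)) \<le> (\<Sum>i\<in>I. g i (A \<union> B))" "int (card (A \<inter> B)) \<le> (\<Sum>i\<in>I. g i (A \<inter> B))"
    using sub by (auto intro!: hall)
  moreover have "0 \<le> (\<Sum>i\<in>I. ?d i)"
    using nonneg by (rule sum_nonneg)
  ultimately have zero: "(\<Sum>i\<in>I. ?d i) = 0"
    and "(\<Sum>i\<in>I. g i (A \<union> B)) = int (card (A \<union> B))" "(\<Sum>i\<in>I. g i (A \<inter> B)) = int (card (A \<inter> B))"
    using sum card by linarith+
  then show "tight (A \<union> B)" "tight (A \<inter> B)"
    using sub by (auto simp: tight_def)
  show "g i (A \<union> B) + g i (A \<inter> B) = g i A + g i B" if "i \<in> I"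
    using zero sum_nonneg_eq_0_iff[OF finite_index, of ?d] nonneg that by fastforce
qed

definition safe :: "'a \<Rightarrow> 'i \<Rightarrow> bool" where
  "safe x i \<longleftrightarrow> (\<forall>A. tight A \<and> x \<notin> A \<longrightarrow> g i A < g i (insert x A))"

lemma ex_safe_index:
  assumes "x \<in> U"
  shows "\<exists>i\<in>I. safe x i"
proof -
  define F where "F = {A. tight A \<and> x \<notin> A}"
  have "finite F"
    by (rule finite_subset[of _ "Pow U"]) (auto simp: F_def tight_def finite_ground)
  moreover have "tight (\<Union>G)" if "finite G" "G \<subseteq> F" for G
    using that by (induction G) (auto simp: tight_empty F_def intro: tight_union)
  ultimately have S: "tight (\<Union>F)"
    by blast
  define S where "S = \<Union>F"
  have tight_S: "tight S" and "x \<notin> S"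
    using S by (auto simp: S_def F_def)
  have "S \<subseteq> U"
    using tight_S by (simp add: tight_def)
  then have "finite S"
    using finite_ground finite_subset by blast
  have "(\<Sum>i\<in>I. g i S) < (\<Sum>i\<in>I. g i (insert x S))"
    using hall[of "insert x S"] tight_S \<open>finite S\<close> \<open>x \<notin> S\<close> \<open>x \<in> U\<close> by (simp add: tight_def)
  then obtain i where i: "i \<in> I" "g i S < g i (insert x S)"
    by (meson not_less sum_mono)
  \<comment> \<open>Diminishing returns: adding \<open>x\<close> to \<open>A\<close> gains at least
    as much as adding it to the larger set \<open>S\<close>.\<close>
  have "g i A < g i (insert x A)" if "tight A" "x \<notin> A" for A
  proof -
    have "A \<subseteq> S"
      using that by (auto simp: S_def F_def)
    have "insert x A \<union> S = insert x S" "insert x A \<inter> S = A"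
      using \<open>A \<subseteq> S\<close> \<open>x \<notin> S\<close> by auto
    then have "g i (insert x S) + g i A \<le> g i (insert x A) + g i S"
      using submodular[OF i(1), of "insert x A" S] \<open>A \<subseteq> S\<close> \<open>S \<subseteq> U\<close> \<open>x \<in> U\<close> by auto
    with i(2) show ?thesis
      by linarith
  qed
  with i(1) show ?thesis
    by (auto simp: safe_def)
qed

text \<open>Serves the turns in which Bob colors: \<open>0 < g i {x}\<close> will mean that color
  \<open>i\<close> is admissible at \<open>x\<close>, so every legal reply of Bob is
  harmless.\<close>

lemma ex_element_safe_at_positive_indices:
  assumes "U \<noteq> {}"
  shows "\<exists>x\<in>U. \<forall>i\<in>I. 0 < g i {x} \<longrightarrow> safe x i"
proof (cases "\<exists>T. T \<noteq> {} \<and> tight T")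
  case True
  obtain T where T: "T \<noteq> {}" "tight T"
    and minimal: "\<And>A. A \<noteq> {} \<Longrightarrow> tight A \<Longrightarrow> card T \<le> card A"
  proof -
    from True obtain T\<^sub>0 where "T\<^sub>0 \<noteq> {} \<and> tight T\<^sub>0"
      by blast
    from ex_has_least_nat[of "\<lambda>T. T \<noteq> {} \<and> tight T", OF this, of card] that show ?thesis
      by blast
  qed
  have "T \<subseteq> U"
    using T by (simp add: tight_def)
  then have "finite T"
    using finite_ground finite_subset by blast
  obtain x where "x \<in> T"
    using T by blast
  have "g i A < g i (insert x A)" if "i \<in> I" "0 < g i {x}" "tight A" "x \<notin> A" for i A
  proof -
    \<comment> \<open>The intersection is tight and misses \<open>x\<close>, hence is smaller than
      the minimal \<open>T\<close> and must be empty.\<close>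
    have "card (A \<inter> T) < card T"
      using \<open>x \<in> T\<close> \<open>x \<notin> A\<close> \<open>finite T\<close> by (intro psubset_card_mono) auto
    then have disj: "A \<inter> T = {}"
      using minimal[OF _ tight_inter[OF \<open>tight A\<close> T(2)]] by (metis not_less)
    have "A \<subseteq> U"
      using \<open>tight A\<close> by (simp add: tight_def)
    have "insert x A \<union> T = A \<union> T" "insert x A \<inter> T = {x}"
      using disj \<open>x \<in> T\<close> by auto
    then have "g i (A \<union> T) + g i {x} \<le> g i (insert x A) + g i T"
      using submodular[OF \<open>i \<in> I\<close>, of "insert x A" T] \<open>A \<subseteq> U\<close> \<open>T \<subseteq> U\<close> \<open>x \<in> T\<close>
      by (metis insert_subset subsetD)
    moreover have "g i (A \<union> T) = g i A + g i T"
      using tight_modular[OF \<open>tight A\<close> T(2) \<open>i \<in> I\<close>] disj empty[OF \<open>i \<in> I\<close>] by simp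
    ultimately show ?thesis
      using \<open>0 < g i {x}\<close> by linarith
  qed
  then show ?thesis
    using \<open>x \<in> T\<close> \<open>T \<subseteq> U\<close> by (auto simp: safe_def)
next
  case False
  \<comment> \<open>The only tight set is now \<open>{}\<close>, where safety reads
    \<open>g i {} < g i {x}\<close>.\<close>
  then have "safe x i" if "i \<in> I" "0 < g i {x}" for x i
    using that empty[of i] unfolding safe_def by metis
  then show ?thesis
    using assms by blast
qed

text \<open>The summands on the right are the functions after \<open>x\<close> has received color
  \<open>i\<close>. If \<open>A\<close> has positive slack, integrality lets the slack pay for the
  -1; if \<open>A\<close> is tight, safety makes the \<open>i\<close>-th term grow by at least 1
  before the subtraction.\<close>

lemma hall_after_safe_step:
  assumes "x \<in> U" "i \<in> I" "safe x i" "A \<subseteq> U - {x}"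
  shows "int (card A) \<le> (\<Sum>j\<in>I. if j = i then g i (insert x A) - 1 else g j A)"
proof -
  have "(\<Sum>j\<in>I. if j = i then g i (insert x A) - 1 else g j A)
      = (g i (insert x A) - 1) + (\<Sum>j\<in>I - {i}. g j A)"
    using finite_index \<open>i \<in> I\<close> by (subst sum.remove[of _ i]) (auto intro!: sum.cong)
  moreover have "(\<Sum>j\<in>I. g j A) = g i A + (\<Sum>j\<in>I - {i}. g j A)"
    using finite_index \<open>i \<in> I\<close> by (rule sum.remove)
  moreover have "int (card A) \<le> (\<Sum>j\<in>I. g j A)"
    using assms by (intro hall) auto
  moreover have "g i A \<le> g i (insert x A)"
    using assms by (intro mono) auto
  moreover have "g i A < g i (insert x A)" if "(\<Sum>j\<in>I. g j A) = int (card A)"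
    using assms that by (auto simp: safe_def tight_def)
  ultimately show ?thesis
    by linarith
qed

end

section \<open>Rank functions of matroids and their contractions\<close>

definition rank :: "('a set \<Rightarrow> bool) \<Rightarrow> 'a set \<Rightarrow> nat" where
  "rank indep X = Max (card ` {B. B \<subseteq> X \<and> indep B})"

text \<open>For independent \<open>C\<close> this is the rank of \<open>A\<close> in the contraction
  by \<open>C\<close>; it lives in \<open>int\<close> so that subtraction is not truncated.\<close>

definition contraction_rank :: "('a set \<Rightarrow> bool) \<Rightarrow> 'a set \<Rightarrow> 'a set \<Rightarrow> int" where
  "contraction_rank indep C A = int (rank indep (C \<union> A)) - int (card C)"

context matroid
begin

lemma finite_indep: "indep X \<Longrightarrow> finite X"
  using indep_subset_ground finite_ground finite_subset by blast

lemma finite_indep_subsets: "finite {B. B \<subseteq> X \<and> indep B}"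
  by (rule finite_subset[of _ "Pow E"]) (auto dest: indep_subset_ground simp: finite_ground)

lemma card_le_rank: "B \<subseteq> X \<Longrightarrow> indep B \<Longrightarrow> card B \<le> rank indep X"
  unfolding rank_def using finite_indep_subsets by (intro Max_ge) auto

lemma obtain_rank_set:
  obtains B where "B \<subseteq> X" "indep B" "card B = rank indep X"
proof -
  have "rank indep X \<in> card ` {B. B \<subseteq> X \<and> indep B}"
    unfolding rank_def using finite_indep_subsets indep_empty by (intro Max_in) auto
  then show ?thesis
    using that by auto
qed

text \<open>A largest independent set between the two bounds cannot be smaller than a maximum
  independent subset of \<open>X\<close>: augmentation from the latter would enlarge it within
  \<open>X\<close>.\<close>

lemma extend_to_rank_set:
  assumes "indep B\<^sub>0" "B\<^sub>0 \<subseteq> X"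
  obtains B where "B\<^sub>0 \<subseteq> B" "B \<subseteq> X" "indep B" "card B = rank indep X"
proof -
  let ?P = "\<lambda>B. B\<^sub>0 \<subseteq> B \<and> B \<subseteq> X \<and> indep B"
  obtain B where B: "?P B" and max: "\<And>B'. ?P B' \<Longrightarrow> card B' \<le> card B"
  proof -
    have "\<forall>B. ?P B \<longrightarrow> card B < Suc (card E)"
      using indep_subset_ground finite_ground by (simp add: card_mono le_imp_less_Suc)
    moreover have "?P B\<^sub>0"
      using assms by blast
    ultimately have "\<exists>B. ?P B \<and> (\<forall>B'. ?P B' \<longrightarrow> card B' \<le> card B)"
      by (intro ex_has_greatest_nat)
    with that show ?thesis
      by blast
  qed
  obtain R where R: "R \<subseteq> X" "indep R" "card R = rank indep X"
    by (rule obtain_rank_set)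
  have "\<not> card B < card R"
  proof
    assume "card B < card R"
    then obtain y where y: "y \<in> R - B" "indep (insert y B)"
      using augmentation B R by blast
    then have "card (insert y B) \<le> card B"
      using B R by (intro max) auto
    then show False
      using y finite_indep B by simp
  qed
  with R have "card B = rank indep X"
    using card_le_rank[of B X] B by linarith
  with B show ?thesis
    using that by blast
qed

lemma rank_mono: "X \<subseteq> Y \<Longrightarrow> rank indep X \<le> rank indep Y"
  by (rule obtain_rank_set[of X]) (metis card_le_rank subset_trans)

lemma rank_indep: "indep X \<Longrightarrow> rank indep X = card X"
  by (rule extend_to_rank_set[of X X]) (auto dest: subset_antisym)

lemma indep_if_card_le_rank:
  assumes "finite X" "card X \<le> rank indep X"
  shows "indep X"
  by (rule obtain_rank_set[of X]) (metis assms card_seteq)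

text \<open>Extend a maximum independent subset of \<open>X \<inter> Y\<close> to one of
  \<open>X \<union> Y\<close> and count its parts in \<open>X\<close> and in \<open>Y\<close>; their
  overlap contains the set started from.\<close>

lemma rank_submodular:
  "rank indep (X \<union> Y) + rank indep (X \<inter> Y) \<le> rank indep X + rank indep Y"
proof -
  obtain B\<^sub>0 where B0: "B\<^sub>0 \<subseteq> X \<inter> Y" "indep B\<^sub>0" "card B\<^sub>0 = rank indep (X \<inter> Y)"
    by (rule obtain_rank_set)
  obtain B where B: "B\<^sub>0 \<subseteq> B" "B \<subseteq> X \<union> Y" "indep B" "card B = rank indep (X \<union> Y)"
    using extend_to_rank_set[of B\<^sub>0 "X \<union> Y"] B0 by blast
  have "finite B"
    using B finite_indep by blast
  have "(B \<inter> X) \<union> (B \<inter> Y) = B"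
    using B by blast
  then have "card (B \<inter> X) + card (B \<inter> Y) = card B + card ((B \<inter> X) \<inter> (B \<inter> Y))"
    using card_Un_Int[of "B \<inter> X" "B \<inter> Y"] \<open>finite B\<close> by simp
  moreover have "card B\<^sub>0 \<le> card ((B \<inter> X) \<inter> (B \<inter> Y))"
    using B B0 \<open>finite B\<close> by (intro card_mono) auto
  moreover have "card (B \<inter> X) \<le> rank indep X" "card (B \<inter> Y) \<le> rank indep Y"
    using B indep_subset by (auto intro!: card_le_rank)
  ultimately show ?thesis
    using B0 B by linarith
qed

lemma contraction_rank_mono:
  "A \<subseteq> B \<Longrightarrow> contraction_rank indep C A \<le> contraction_rank indep C B"
  unfolding contraction_rank_def using rank_mono[of "C \<union> A" "C \<union> B"] by auto

lemma contraction_rank_submodular: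
  "contraction_rank indep C (A \<union> B) + contraction_rank indep C (A \<inter> B)
    \<le> contraction_rank indep C A + contraction_rank indep C B"
proof -
  have "C \<union> A \<union> (C \<union> B) = C \<union> (A \<union> B)" "(C \<union> A) \<inter> (C \<union> B) = C \<union> (A \<inter> B)"
    by auto
  then show ?thesis
    unfolding contraction_rank_def using rank_submodular[of "C \<union> A" "C \<union> B"] by simp
qed

lemma contraction_rank_empty: "indep C \<Longrightarrow> contraction_rank indep C {} = 0"
  by (simp add: contraction_rank_def rank_indep)

lemma contraction_rank_singleton_pos_iff:
  assumes "indep C" "x \<notin> C"
  shows "0 < contraction_rank indep C {x} \<longleftrightarrow> indep (insert x C)"
proof
  assume "0 < contraction_rank indep C {x}"
  then have "card (insert x C) \<le> rank indep (insert x C)"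
    using assms finite_indep by (simp add: contraction_rank_def)
  then show "indep (insert x C)"
    using assms finite_indep by (intro indep_if_card_le_rank) auto
next
  assume "indep (insert x C)"
  then show "0 < contraction_rank indep C {x}"
    using assms finite_indep by (simp add: contraction_rank_def rank_indep)
qed

text \<open>Coloring \<open>x\<close> moves it from the argument to the contracted set, so only the
  subtracted cardinality changes. This is the source of the -1 in
  \<open>hall_after_safe_step\<close>.\<close>

lemma contraction_rank_insert:
  assumes "finite C" "x \<notin> C"
  shows "contraction_rank indep (insert x C) A = contraction_rank indep C (insert x A) - 1"
  using assms by (simp add: contraction_rank_def)

end

section \<open>Winning by an invariant\<close>

lemma ex_winning_strategy_by_invariant:
  assumes start: "P ([], Bob_Chooses_Kind)"
    and Bob: "\<And>p q. P p \<Longrightarrow> \<not> Alice_to_move p \<Longrightarrow> move E k indep p q \<Longrightarrow> P q"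
    and Alice: "\<And>p. P p \<Longrightarrow> Alice_to_move p \<Longrightarrow> \<not> game_over E k indep p \<Longrightarrow>
      \<exists>q. move E k indep p q \<and> P q"
    and over: "\<And>h s. P (h, s) \<Longrightarrow> game_over E k indep (h, s) \<Longrightarrow> uncolored E h = {}"
  shows "\<exists>\<sigma>. Alice_winning_strategy E k indep \<sigma>"
proof -
  \<comment> \<open>A strategy must move legally even at positions violating \<open>P\<close>, so
    legality is demanded separately from preserving \<open>P\<close>.\<close>
  have "\<forall>p. \<exists>q. (\<not> game_over E k indep p \<longrightarrow> move E k indep p q) \<and>
      (P p \<and> Alice_to_move p \<and> \<not> game_over E k indep p \<longrightarrow> P q)"
    using Alice by (metis game_over_def)
  then obtain \<sigma> where legal: "\<And>p. \<not> game_over E k indep p \<Longrightarrow> move E k indep p (\<sigma> p)"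
    and keep: "\<And>p. P p \<Longrightarrow> Alice_to_move p \<Longrightarrow> \<not> game_over E k indep p \<Longrightarrow> P (\<sigma> p)"
    by metis
  have "P p" if "consistent E k indep \<sigma> p" for p
    using that by induction (blast intro: start Bob keep)+
  then show ?thesis
    unfolding Alice_winning_strategy_def Alice_strategy_def using legal over by blast
qed

section \<open>The coloring game\<close>

locale matroid_family =
  fixes E :: "'a set" and k :: nat and indep :: "nat \<Rightarrow> 'a set \<Rightarrow> bool"
  assumes finite_ground: "finite E"
    and matroid: "i \<in> {1..k} \<Longrightarrow> matroid E (indep i)"
begin

definition residual_rank :: "('a \<rightharpoonup> nat) \<Rightarrow> nat \<Rightarrow> 'a set \<Rightarrow> int" where
  "residual_rank c i = contraction_rank (indep i) {x. c x = Some i}"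

definition hall_coloring :: "('a \<rightharpoonup> nat) \<Rightarrow> bool" where
  "hall_coloring c \<longleftrightarrow> proper k indep c \<and>
    (\<forall>A \<subseteq> E - dom c. int (card A) \<le> (\<Sum>i\<in>{1..k}. residual_rank c i A))"

lemma indep_color_class: "proper k indep c \<Longrightarrow> i \<in> {1..k} \<Longrightarrow> indep i {x. c x = Some i}"
  by (simp add: proper_def)

lemma hall_system_residual_rank:
  assumes "hall_coloring c"
  shows "hall_system {1..k} (E - dom c) (residual_rank c)"
proof
  fix i A B
  assume i: "i \<in> {1..k}"
  interpret matroid E "indep i"
    using i by (rule matroid)
  show "residual_rank c i A \<le> residual_rank c i B" if "A \<subseteq> B"
    using that unfolding residual_rank_def by (rule contraction_rank_mono)
  show "residual_rank c i (A \<union> B) + residual_rank c i (A \<inter> B)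
      \<le> residual_rank c i A + residual_rank c i B"
    unfolding residual_rank_def by (rule contraction_rank_submodular)
  show "residual_rank c i {} = 0"
    using assms i unfolding residual_rank_def hall_coloring_def
    by (intro contraction_rank_empty indep_color_class) auto
qed (use assms finite_ground in \<open>auto simp: hall_coloring_def\<close>)

lemma color_class_update:
  assumes "x \<notin> dom c"
  shows "{y. (c(x \<mapsto> i)) y = Some j} = (if j = i then insert x {y. c y = Some j} else {y. c y = Some j})"
  using assms by auto

lemma proper_update_iff:
  assumes "proper k indep c" "x \<notin> dom c" "i \<in> {1..k}"
  shows "proper k indep (c(x \<mapsto> i)) \<longleftrightarrow> 0 < residual_rank c i {x}"
proof -
  interpret matroid E "indep i"
    using assms(3) by (rule matroid)
  have "proper k indep (c(x \<mapsto> i)) \<longleftrightarrow> indep i (insert x {y. c y = Some i})"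
    using assms(1,3) unfolding proper_def color_class_update[OF assms(2)] by auto
  also have "\<dots> \<longleftrightarrow> 0 < residual_rank c i {x}"
    unfolding residual_rank_def
    using assms by (intro contraction_rank_singleton_pos_iff[symmetric] indep_color_class) auto
  finally show ?thesis .
qed

lemma hall_coloring_update:
  assumes "hall_coloring c" "x \<in> E - dom c" "i \<in> {1..k}"
    and safe: "hall_system.safe {1..k} (E - dom c) (residual_rank c) x i"
  shows "hall_coloring (c(x \<mapsto> i))"
proof -
  interpret hall_system "{1..k}" "E - dom c" "residual_rank c"
    using assms(1) by (rule hall_system_residual_rank)
  have proper: "proper k indep c"
    using assms(1) by (simp add: hall_coloring_def)
  \<comment> \<open>Safety applied to the tight set \<open>{}\<close> shows that a safe color is
    admissible.\<close>
  have "0 < residual_rank c i {x}"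
    using safe tight_empty empty[OF assms(3)] unfolding safe_def by (metis empty_iff)
  then have "proper k indep (c(x \<mapsto> i))"
    using proper_update_iff proper assms(2,3) by simp
  moreover have "int (card A) \<le> (\<Sum>j\<in>{1..k}. residual_rank (c(x \<mapsto> i)) j A)"
    if "A \<subseteq> E - dom (c(x \<mapsto> i))" for A
  proof -
    interpret M: matroid E "indep i"
      using assms(3) by (rule matroid)
    have "residual_rank (c(x \<mapsto> i)) j A
        = (if j = i then residual_rank c i (insert x A) - 1 else residual_rank c j A)" for j
      using assms(2) M.finite_indep[OF indep_color_class[OF proper assms(3)]]
        M.contraction_rank_insert[of "{y. c y = Some i}" x A]
      unfolding residual_rank_def by (subst color_class_update) auto
    moreover have "A \<subseteq> E - dom c - {x}"
      using that by auto
    ultimately show ?thesis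
      using hall_after_safe_step[OF assms(2,3) safe] by simp
  qed
  ultimately show ?thesis
    by (simp add: hall_coloring_def)
qed

lemma ex_good_color:
  assumes "hall_coloring c" "x \<in> E - dom c"
  shows "\<exists>i\<in>{1..k}. hall_coloring (c(x \<mapsto> i))"
  using hall_system.ex_safe_index[OF hall_system_residual_rank[OF assms(1)] assms(2)]
    hall_coloring_update[OF assms] by blast

lemma ex_good_element:
  assumes "hall_coloring c" "E - dom c \<noteq> {}"
  shows "\<exists>x\<in>E - dom c. \<forall>i\<in>{1..k}. proper k indep (c(x \<mapsto> i)) \<longrightarrow> hall_coloring (c(x \<mapsto> i))"
proof -
  obtain x where x: "x \<in> E - dom c"
    and "\<And>i. i \<in> {1..k} \<Longrightarrow> 0 < residual_rank c i {x} \<Longrightarrow>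
      hall_system.safe {1..k} (E - dom c) (residual_rank c) x i"
    using hall_system.ex_element_safe_at_positive_indices[OF hall_system_residual_rank] assms
    by meson
  then show ?thesis
    using hall_coloring_update[OF assms(1) x] proper_update_iff[of c x] assms(1)
    by (metis DiffE hall_coloring_def)
qed

lemma hall_coloring_empty:
  assumes "\<And>i. i \<in> {1..k} \<Longrightarrow> indep i (V i)" and "(\<Union>i\<in>{1..k}. V i) = E"
  shows "hall_coloring Map.empty"
proof -
  have "int (card A) \<le> (\<Sum>i\<in>{1..k}. residual_rank Map.empty i A)" if "A \<subseteq> E" for A
  proof -
    have "(\<Union>i\<in>{1..k}. A \<inter> V i) = A"
      using that assms(2) by auto
    then have "card A \<le> (\<Sum>i\<in>{1..k}. card (A \<inter> V i))"
      using card_UN_le[of "{1..k}" "\<lambda>i. A \<inter> V i"] by simp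
    also have "\<dots> \<le> (\<Sum>i\<in>{1..k}. rank (indep i) A)"
    proof (rule sum_mono)
      fix i assume i: "i \<in> {1..k}"
      interpret matroid E "indep i"
        using i by (rule matroid)
      show "card (A \<inter> V i) \<le> rank (indep i) A"
        using indep_subset[OF assms(1)[OF i]] by (intro card_le_rank) auto
    qed
    finally show ?thesis
      by (simp add: residual_rank_def contraction_rank_def flip: of_nat_sum)
  qed
  moreover have "proper k indep Map.empty"
    using matroid matroid.indep_empty by (fastforce simp: proper_def)
  ultimately show ?thesis
    by (simp add: hall_coloring_def)
qed

text \<open>When Bob is to color, the invariant must already cover all his admissible replies. When
  Alice is to color, the Hall condition alone supplies a good color, so nothing is demanded of the
  other colors.\<close>

fun good_position :: "'a position \<Rightarrow> bool" where
  "good_position (h, Bob_Colors x) \<longleftrightarrow> hall_coloring (coloring h) \<and> x \<in> uncolored E h \<and>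
    (\<forall>i. admissible k indep h x i \<longrightarrow> hall_coloring ((coloring h)(x \<mapsto> i)))"
| "good_position (h, Alice_Colors x) \<longleftrightarrow> hall_coloring (coloring h) \<and> x \<in> uncolored E h"
| "good_position (h, _) \<longleftrightarrow> hall_coloring (coloring h)"

lemma ex_good_admissible:
  assumes "hall_coloring (coloring h)" "x \<in> uncolored E h"
  shows "\<exists>i. admissible k indep h x i \<and> hall_coloring ((coloring h)(x \<mapsto> i))"
proof -
  have "x \<in> E - dom (coloring h)"
    using assms(2) by (simp only: uncolored_def)
  then show ?thesis
    using ex_good_color[OF assms(1)] unfolding admissible_def hall_coloring_def by blast
qed

lemma good_position_Bob_move:
  assumes "good_position p" "\<not> Alice_to_move p" "move E k indep p q"
  shows "good_position q"
  using assms(3,1,2) by cases auto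

lemma good_position_Alice_move:
  assumes "good_position p" "Alice_to_move p" "\<not> game_over E k indep p"
  shows "\<exists>q. move E k indep p q \<and> good_position q"
proof -
  obtain q where "move E k indep p q"
    using assms(3) by (auto simp: game_over_def)
  then show ?thesis
  proof cases
    case (Alice_indicates y h)
    \<comment> \<open>The given move only witnesses that some element is uncolored; its
      \<open>y\<close> is discarded for a good \<open>x\<close>. The cited equation of
      \<open>good_position\<close> is the one for \<open>Alice_Indicates\<close>.\<close>
    then obtain x where "x \<in> uncolored E h"
      "\<forall>i. admissible k indep h x i \<longrightarrow> hall_coloring ((coloring h)(x \<mapsto> i))"
      using ex_good_element[of "coloring h"] assms(1)
      unfolding uncolored_def admissible_def by (metis empty_iff good_position.simps(4))
    then show ?thesis
      using Alice_indicates assms(1)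
      by (intro exI[of _ "(h, Bob_Colors x)"]) (auto intro: move.Alice_indicates)
  next
    case (Alice_colors h x)
    then obtain i where "admissible k indep h x i" "hall_coloring ((coloring h)(x \<mapsto> i))"
      using ex_good_admissible assms(1) by auto
    then show ?thesis
      using Alice_colors
      by (intro exI[of _ "(Bob_Indicated x i # h, Bob_Chooses_Kind)"])
        (auto intro: move.Alice_colors)
  qed (use assms(2) in auto)
qed

text \<open>In a coloring stage the invariant provides an admissible color, so the game is not over
  there; in the other stages a move is missing only if every element is colored.\<close>

lemma good_position_game_over:
  assumes "good_position (h, s)" "game_over E k indep (h, s)"
  shows "uncolored E h = {}"
proof (cases s)
  case (Bob_Colors x)
  then have "\<exists>i. admissible k indep h x i"
    using ex_good_admissible[of h x] assms(1) by auto
  then show ?thesis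
    using assms(2) Bob_Colors move.Bob_colors by (metis game_over_def)
next
  case (Alice_Colors x)
  then have "\<exists>i. admissible k indep h x i"
    using ex_good_admissible[of h x] assms(1) by auto
  then show ?thesis
    using assms(2) Alice_Colors move.Alice_colors by (metis game_over_def)
qed (metis assms(2) equals0I game_over_def move.choose_first_kind move.Alice_indicates
    move.Bob_indicates)+

end

theorem theorem5:
  fixes E :: "'a set" and k :: nat
    and indep :: "nat \<Rightarrow> 'a set \<Rightarrow> bool" and V :: "nat \<Rightarrow> 'a set"
  assumes "finite E"
    and "\<And>i. i \<in> {1..k} \<Longrightarrow> matroid E (indep i)"
    and "\<And>i. i \<in> {1..k} \<Longrightarrow> indep i (V i)"
    and "(\<Union>i\<in>{1..k}. V i) = E"
  shows "\<exists>\<sigma>. Alice_winning_strategy E k indep \<sigma>"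
proof -
  interpret matroid_family E k indep
    using assms(1,2) by (rule matroid_family.intro)
  show ?thesis
  proof (rule ex_winning_strategy_by_invariant[where P = good_position])
    show "good_position ([], Bob_Chooses_Kind)"
      using hall_coloring_empty[OF assms(3,4)] by simp
  qed (fact good_position_Bob_move good_position_Alice_move good_position_game_over)+
qed

end
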